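(* Let $\alpha,\beta,\gamma,\delta\in\mathbb{R}$ with $\alpha+\delta\neq0$ and $\alpha\gamma=0$, and let $(G_7,g,J)$ be the connected, simply connected three-dimensional Lie group with left-invariant Lorentzian metric $g$ whose Lie algebra $\mathfrak{g}$ has a pseudo-orthonormal basis $\{e_1,e_2,e_3\}$ with $e_3$ timelike such that $$[e_1,e_2]=-\alpha e_1-\beta e_2-\beta e_3,\quad [e_1,e_3]=\alpha e_1+\beta e_2+\beta e_3,\quad [e_2,e_3]=\gamma e_1+\delta e_2+\delta e_3,$$ equipped with the product structure $Je_1=e_1$, $Je_2=e_2$, $Je_3=-e_3$. Let $c\in\mathbb{R}$. Then $(G_7,g,J)$ is a first kind algebraic Wanas soliton associated to the canonical connection $\nabla^0$ with constant $c$ (i.e. $\mathrm{Wan}^0=c\,\mathrm{Id}+D$ with $D$ a derivation of $\mathfrak g$) if and only if $\alpha=\gamma=0$, $\beta^2+c=0$ and $\delta\neq0$. In particular, in this case $De_1=0$, $De_2=-(\beta^2+\delta^2)e_2-(\beta^2+\delta^2)e_3$, $De_3=(\beta^2+\delta^2)e_2+(\beta^2+\delta^2)e_3$.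
   Context: Pseudo-orthonormal with $e_3$ timelike means $g(e_1,e_1)=g(e_2,e_2)=1$, $g(e_3,e_3)=-1$, $g(e_i,e_j)=0$ for $i\ne j$. All tensors are left-invariant and evaluated on the Lie algebra $\mathfrak{g}$ of left-invariant vector fields. Let $\nabla$ be the Levi-Civita connection of $g$, and let $J$ be the product structure given in the claim, with $(\nabla_XJ)Y=\nabla_X(JY)-J(\nabla_XY)$. Canonical connection: $\nabla^0_XY=\nabla_XY-\frac12(\nabla_XJ)JY$. Curvature: $R^0(X,Y)Z=\nabla^0_X\nabla^0_YZ-\nabla^0_Y\nabla^0_XZ-\nabla^0_{[X,Y]}Z$. Torsion: $T^0(X,Y)=\nabla^0_XY-\nabla^0_YX-[X,Y]$. $A^0(X,Y)Z=T^0(T^0(X,Y),Z)$, and the Wanas tensor is $W^0(X,Y)Z=R^0(X,Y)Z-A^0(X,Y)Z$. $w^0(X,Y)=-g(W^0(X,e_1)Y,e_1)-g(W^0(X,e_2)Y,e_2)+g(W^0(X,e_3)Y,e_3)$. The operator $\mathrm{Wan}^0:\mathfrak g\to\mathfrak g$ is defined by $w^0(X,Y)=g(\mathrm{Wan}^0(X),Y)$. A derivation of $\mathfrak g$ is a linear map $D$ with $D[X,Y]=[DX,Y]+[X,DY]$ for all $X,Y\in\mathfrak g$. $(G_7,g,J)$ is a first kind algebraic Wanas soliton associated to $\nabla^0$ (with constant $c$) if $\mathrm{Wan}^0=c\,\mathrm{Id}+D$ for the real number $c$ and a derivation $D$ of $\mathfrak g$. *)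

theory Defs
  imports "HOL-Analysis.Analysis"
begin

(* A Lie group with left-invariant tensors is represented by its Lie algebra: a real vector
   space 'v with a bracket br, and left-invariant tensors as (multi)linear maps on 'v. *)

definition lie_bracket :: "('v::real_vector \<Rightarrow> 'v \<Rightarrow> 'v) \<Rightarrow> bool" where
  "lie_bracket br \<longleftrightarrow> bilinear br \<and> (\<forall>X. br X X = 0) \<and>
     (\<forall>X Y Z. br X (br Y Z) + br Y (br Z X) + br Z (br X Y) = 0)"

definition derivation :: "('v::real_vector \<Rightarrow> 'v \<Rightarrow> 'v) \<Rightarrow> ('v \<Rightarrow> 'v) \<Rightarrow> bool" where
  "derivation br D \<longleftrightarrow> linear D \<and> (\<forall>X Y. D (br X Y) = br (D X) Y + br X (D Y))"

definition pseudo_orthonormal_basis ::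
    "('v::real_vector \<Rightarrow> 'v \<Rightarrow> real) \<Rightarrow> 'v \<Rightarrow> 'v \<Rightarrow> 'v \<Rightarrow> bool" where
  "pseudo_orthonormal_basis g e1 e2 e3 \<longleftrightarrow>
     distinct [e1, e2, e3] \<and> independent {e1, e2, e3} \<and> span {e1, e2, e3} = UNIV \<and>
     g e1 e1 = 1 \<and> g e2 e2 = 1 \<and> g e3 e3 = -1 \<and>
     g e1 e2 = 0 \<and> g e2 e1 = 0 \<and> g e1 e3 = 0 \<and> g e3 e1 = 0 \<and> g e2 e3 = 0 \<and> g e3 e2 = 0"

definition torsion ::
    "('v::real_vector \<Rightarrow> 'v \<Rightarrow> 'v) \<Rightarrow> ('v \<Rightarrow> 'v \<Rightarrow> 'v) \<Rightarrow> 'v \<Rightarrow> 'v \<Rightarrow> 'v" where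
  "torsion br nab X Y = nab X Y - nab Y X - br X Y"

definition curvature ::
    "('v::real_vector \<Rightarrow> 'v \<Rightarrow> 'v) \<Rightarrow> ('v \<Rightarrow> 'v \<Rightarrow> 'v) \<Rightarrow> 'v \<Rightarrow> 'v \<Rightarrow> 'v \<Rightarrow> 'v" where
  "curvature br nab X Y Z = nab X (nab Y Z) - nab Y (nab X Z) - nab (br X Y) Z"

(* In the metric condition X(g(Y,Z)) = g(nab_X Y, Z) + g(Y, nab_X Z) the left-hand side vanishes,
   because g(Y,Z) is constant for left-invariant fields Y and Z. *)
definition is_levi_civita ::
    "('v::real_vector \<Rightarrow> 'v \<Rightarrow> 'v) \<Rightarrow> ('v \<Rightarrow> 'v \<Rightarrow> real) \<Rightarrow> ('v \<Rightarrow> 'v \<Rightarrow> 'v) \<Rightarrow> bool" where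
  "is_levi_civita br g nab \<longleftrightarrow> bilinear nab \<and>
     (\<forall>X Y. torsion br nab X Y = 0) \<and>
     (\<forall>X Y Z. g (nab X Y) Z + g Y (nab X Z) = 0)"

definition levi_civita ::
    "('v::real_vector \<Rightarrow> 'v \<Rightarrow> 'v) \<Rightarrow> ('v \<Rightarrow> 'v \<Rightarrow> real) \<Rightarrow> 'v \<Rightarrow> 'v \<Rightarrow> 'v" where
  "levi_civita br g = (THE nab. is_levi_civita br g nab)"

definition cov_deriv_endo ::
    "('v::real_vector \<Rightarrow> 'v \<Rightarrow> 'v) \<Rightarrow> ('v \<Rightarrow> 'v) \<Rightarrow> 'v \<Rightarrow> 'v \<Rightarrow> 'v" where
  "cov_deriv_endo nab J X Y = nab X (J Y) - J (nab X Y)"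

definition canonical_connection ::
    "('v::real_vector \<Rightarrow> 'v \<Rightarrow> 'v) \<Rightarrow> ('v \<Rightarrow> 'v \<Rightarrow> real) \<Rightarrow> ('v \<Rightarrow> 'v) \<Rightarrow> 'v \<Rightarrow> 'v \<Rightarrow> 'v" where
  "canonical_connection br g J X Y =
     levi_civita br g X Y - (1/2) *\<^sub>R cov_deriv_endo (levi_civita br g) J X (J Y)"

definition wanas_tensor ::
    "('v::real_vector \<Rightarrow> 'v \<Rightarrow> 'v) \<Rightarrow> ('v \<Rightarrow> 'v \<Rightarrow> 'v) \<Rightarrow> 'v \<Rightarrow> 'v \<Rightarrow> 'v \<Rightarrow> 'v" where
  "wanas_tensor br nab X Y Z =
     curvature br nab X Y Z - torsion br nab (torsion br nab X Y) Z"

definition wanas_form ::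
    "('v::real_vector \<Rightarrow> 'v \<Rightarrow> 'v) \<Rightarrow> ('v \<Rightarrow> 'v \<Rightarrow> real) \<Rightarrow> ('v \<Rightarrow> 'v \<Rightarrow> 'v) \<Rightarrow>
     'v \<Rightarrow> 'v \<Rightarrow> 'v \<Rightarrow> 'v \<Rightarrow> 'v \<Rightarrow> real" where
  "wanas_form br g nab e1 e2 e3 X Y =
     - g (wanas_tensor br nab X e1 Y) e1
     - g (wanas_tensor br nab X e2 Y) e2
     + g (wanas_tensor br nab X e3 Y) e3"

(* Unique, and linear, whenever g is nondegenerate. *)
definition wanas_operator ::
    "('v::real_vector \<Rightarrow> 'v \<Rightarrow> 'v) \<Rightarrow> ('v \<Rightarrow> 'v \<Rightarrow> real) \<Rightarrow> ('v \<Rightarrow> 'v \<Rightarrow> 'v) \<Rightarrow>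
     'v \<Rightarrow> 'v \<Rightarrow> 'v \<Rightarrow> 'v \<Rightarrow> 'v" where
  "wanas_operator br g nab e1 e2 e3 =
     (THE W. \<forall>X Y. wanas_form br g nab e1 e2 e3 X Y = g (W X) Y)"

definition wanas_soliton_with ::
    "('v::real_vector \<Rightarrow> 'v \<Rightarrow> 'v) \<Rightarrow> ('v \<Rightarrow> 'v \<Rightarrow> real) \<Rightarrow> ('v \<Rightarrow> 'v) \<Rightarrow>
     'v \<Rightarrow> 'v \<Rightarrow> 'v \<Rightarrow> real \<Rightarrow> ('v \<Rightarrow> 'v) \<Rightarrow> bool" where
  "wanas_soliton_with br g J e1 e2 e3 c D \<longleftrightarrow> derivation br D \<and>
     (\<forall>X. wanas_operator br g (canonical_connection br g J) e1 e2 e3 X = c *\<^sub>R X + D X)"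

definition first_kind_wanas_soliton ::
    "('v::real_vector \<Rightarrow> 'v \<Rightarrow> 'v) \<Rightarrow> ('v \<Rightarrow> 'v \<Rightarrow> real) \<Rightarrow> ('v \<Rightarrow> 'v) \<Rightarrow>
     'v \<Rightarrow> 'v \<Rightarrow> 'v \<Rightarrow> real \<Rightarrow> bool" where
  "first_kind_wanas_soliton br g J e1 e2 e3 c \<longleftrightarrow>
     (\<exists>D. wanas_soliton_with br g J e1 e2 e3 c D)"

end

theory Submission
  imports Defs
begin

text \<open>
  Koszul's formula gives the Levi-Civita connection, hence \<open>\<nabla>\<^sup>0\<close> and the Wanas operator, explicitly in the
  frame. The soliton equation forces \<open>D = Wan\<^sup>0 - c Id\<close>, so only the derivation identity on the brackets of frame
  vectors has to be tested. If \<open>\<alpha> \<noteq> 0\<close>, then \<open>\<gamma> = 0\<close>, and the \<open>e\<^sub>1\<close>-components for \<open>[e\<^sub>1, e\<^sub>2]\<close> and \<open>[e\<^sub>1, e\<^sub>3]\<close> read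
  \<open>\<alpha>(c + \<beta>\<^sup>2 + \<alpha>\<^sup>2) = 0\<close> and \<open>\<alpha>(c + \<beta>\<^sup>2) = 0\<close>, a contradiction. If \<open>\<alpha> = 0\<close>, then \<open>\<delta> \<noteq> 0\<close>, and the
  equations reduce to \<open>\<gamma>\<^sup>2 \<delta> = 0\<close> and \<open>\<delta>(\<beta>\<^sup>2 + c) = 0\<close>.
\<close>

lemma lie_bracket_anticommute:
  assumes "lie_bracket br"
  shows "br X Y = - br Y X"
proof -
  have "br (X + Y) (X + Y) = 0" "br X X = 0" "br Y Y = 0" and bil: "bilinear br"
    using assms by (simp_all add: lie_bracket_def)
  then have "br Y X + br X Y = 0"
    by (simp add: bilinear_ladd[OF bil] bilinear_radd[OF bil])
  then show ?thesis
    by (simp add: eq_neg_iff_add_eq_0 add.commute)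
qed

section \<open>Linear algebra of a Lorentzian frame and its Levi-Civita connection\<close>

locale lorentz_frame =
  fixes g :: "'v::real_vector \<Rightarrow> 'v \<Rightarrow> real" and e1 e2 e3 :: 'v
  assumes bilinear_g: "bilinear g"
    and g_commute: "g X Y = g Y X"
    and frame: "pseudo_orthonormal_basis g e1 e2 e3"
begin

lemma g_frame [simp]:
  "g e1 e1 = 1" "g e2 e2 = 1" "g e3 e3 = -1"
  "g e1 e2 = 0" "g e2 e1 = 0" "g e1 e3 = 0" "g e3 e1 = 0" "g e2 e3 = 0" "g e3 e2 = 0"
  using frame by (simp_all add: pseudo_orthonormal_basis_def)

lemmas g_simps = bilinear_ladd[OF bilinear_g] bilinear_radd[OF bilinear_g]
  bilinear_lsub[OF bilinear_g] bilinear_rsub[OF bilinear_g]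
  bilinear_lmul[OF bilinear_g] bilinear_rmul[OF bilinear_g]
  bilinear_lneg[OF bilinear_g] bilinear_rneg[OF bilinear_g]

text \<open>Packing coordinates into one constant turns vector identities into polynomial identities
  over the reals, through \<open>comb_arith\<close> and \<open>comb_eq_iff\<close>.\<close>

definition comb :: "real \<Rightarrow> real \<Rightarrow> real \<Rightarrow> 'v" where
  "comb x y z = x *\<^sub>R e1 + y *\<^sub>R e2 + z *\<^sub>R e3"

lemma comb_frame: "comb 1 0 0 = e1" "comb 0 1 0 = e2" "comb 0 0 1 = e3"
  by (simp_all add: comb_def)

lemma linear_comb:
  assumes "linear f"
  shows "f (comb x y z) = x *\<^sub>R f e1 + y *\<^sub>R f e2 + z *\<^sub>R f e3"
  by (simp add: comb_def linear_add[OF assms] linear_scale[OF assms])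

lemma bilinear_comb:
  assumes "bilinear h"
  shows "h (comb x y z) (comb x' y' z') =
    (x * x') *\<^sub>R h e1 e1 + (x * y') *\<^sub>R h e1 e2 + (x * z') *\<^sub>R h e1 e3 +
    (y * x') *\<^sub>R h e2 e1 + (y * y') *\<^sub>R h e2 e2 + (y * z') *\<^sub>R h e2 e3 +
    (z * x') *\<^sub>R h e3 e1 + (z * y') *\<^sub>R h e3 e2 + (z * z') *\<^sub>R h e3 e3"
  by (simp add: comb_def bilinear_ladd[OF assms] bilinear_radd[OF assms]
      bilinear_lmul[OF assms] bilinear_rmul[OF assms] algebra_simps)

lemma g_comb: "g (comb x y z) (comb x' y' z') = x * x' + y * y' - z * z'"
  by (simp add: bilinear_comb[OF bilinear_g])

lemma comb_eq_iff: "comb x y z = comb x' y' z' \<longleftrightarrow> x = x' \<and> y = y' \<and> z = z'"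
proof
  assume eq: "comb x y z = comb x' y' z'"
  have "g (comb x y z) (comb a b c) = g (comb x' y' z') (comb a b c)" for a b c
    using eq by simp
  from this[of 1 0 0] this[of 0 1 0] this[of 0 0 1]
  show "x = x' \<and> y = y' \<and> z = z'" by (simp add: g_comb)
qed simp

lemma comb_arith:
  "comb x y z + comb x' y' z' = comb (x + x') (y + y') (z + z')"
  "comb x y z - comb x' y' z' = comb (x - x') (y - y') (z - z')"
  "- comb x y z = comb (- x) (- y) (- z)"
  "k *\<^sub>R comb x y z = comb (k * x) (k * y) (k * z)"
  by (simp_all add: comb_def algebra_simps)

text \<open>Both sides are linear in \<open>X\<close> and agree on the spanning frame; the sign of
  the last coordinate compensates \<open>g e3 e3 = -1\<close>.\<close>

lemma comb_g: "comb (g X e1) (g X e2) (- g X e3) = X"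
proof -
  have linear: "linear (\<lambda>X. comb (g X e1) (g X e2) (- g X e3))"
    by (rule linearI) (simp_all add: comb_arith g_simps)
  have on_frame: "comb (g b e1) (g b e2) (- g b e3) = b" if "b \<in> {e1, e2, e3}" for b
    using that by (auto simp: comb_def)
  have "X \<in> span {e1, e2, e3}"
    using frame by (simp add: pseudo_orthonormal_basis_def)
  from linear_eq_on_span[OF linear linear_ident on_frame this] show ?thesis
    by simp
qed

lemma comb_cases: obtains x y z where "X = comb x y z"
  by (rule that[OF comb_g[symmetric]])

lemma nondegenerate:
  assumes "\<And>Z. g X Z = g Y Z"
  shows "X = Y"
proof -
  have "comb (g X e1) (g X e2) (- g X e3) = comb (g Y e1) (g Y e2) (- g Y e3)"
    by (simp only: assms)
  then show ?thesis
    by (simp only: comb_g)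
qed

text \<open>The musical isomorphism of \<open>g\<close>: a linear form is sent to the vector
  representing it.\<close>

definition sharp :: "('v \<Rightarrow> real) \<Rightarrow> 'v" where
  "sharp \<phi> = comb (\<phi> e1) (\<phi> e2) (- \<phi> e3)"

lemma sharp_comb: "sharp \<phi> = comb (\<phi> (comb 1 0 0)) (\<phi> (comb 0 1 0)) (- \<phi> (comb 0 0 1))"
  by (simp add: sharp_def comb_frame)

lemma g_sharp:
  assumes "linear \<phi>"
  shows "g (sharp \<phi>) Z = \<phi> Z"
proof -
  obtain x y z where "Z = comb x y z" by (rule comb_cases)
  then show ?thesis
    by (simp add: sharp_def g_comb linear_comb[OF assms])
qed

text \<open>Half the right-hand side of Koszul's formula; its derivative terms vanish because
  \<open>g\<close> is constant on left-invariant fields.\<close>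

definition koszul :: "('v \<Rightarrow> 'v \<Rightarrow> 'v) \<Rightarrow> 'v \<Rightarrow> 'v \<Rightarrow> 'v \<Rightarrow> real" where
  "koszul br X Y Z = (g (br X Y) Z - g (br Y Z) X + g (br Z X) Y) / 2"

text \<open>Zero torsion replaces each bracket by a difference of \<open>nab\<close> terms; metric
  skewness then cancels all but two equal ones.\<close>

lemma is_levi_civita_koszul:
  assumes "is_levi_civita br g nab"
  shows "g (nab X Y) Z = koszul br X Y Z"
proof -
  have "torsion br nab X Y = 0" for X Y
    using assms by (simp only: is_levi_civita_def)
  then have br: "br X Y = nab X Y - nab Y X" for X Y
    by (simp only: torsion_def right_minus_eq)
  have "g (nab X Y) Z + g Y (nab X Z) = 0" for X Y Z
    using assms by (simp only: is_levi_civita_def)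
  then have skew: "g (nab X Y) Z = - g (nab X Z) Y" for X Y Z
    by (metis g_commute eq_neg_iff_add_eq_0)
  show ?thesis
    unfolding koszul_def br g_simps skew[of Y Z X] skew[of Z X Y] skew[of X Z Y]
    by simp
qed

text \<open>Representing \<open>koszul\<close> by \<open>sharp\<close> gives existence, and
  \<open>is_levi_civita_koszul\<close> with nondegeneracy gives uniqueness, so the definite
  description is resolved.\<close>

lemma
  assumes "lie_bracket br"
  shows levi_civita_eq_sharp: "levi_civita br g = (\<lambda>X Y. sharp (koszul br X Y))" (is "_ = ?nab")
    and is_levi_civita_levi_civita: "is_levi_civita br g (levi_civita br g)"
proof -
  have bil: "bilinear br"
    using assms by (simp add: lie_bracket_def)
  note br_simps = bilinear_ladd[OF bil] bilinear_radd[OF bil] bilinear_lmul[OF bil] bilinear_rmul[OF bil]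
  note anti = lie_bracket_anticommute[OF assms]
  have lin: "linear (koszul br X Y)" for X Y
    by (rule linearI) (simp_all add: koszul_def br_simps g_simps field_simps)
  note nab = g_sharp[OF lin]
  have lc: "is_levi_civita br g ?nab"
    unfolding is_levi_civita_def
  proof (intro conjI allI)
    show "bilinear ?nab"
      unfolding bilinear_def
      \<comment> \<open>Linearity in each slot is tested by pairing with an arbitrary vector, where
        \<open>nab\<close> exposes the Koszul form.\<close>
      by (intro conjI allI linearI; rule nondegenerate;
          simp add: nab g_simps; simp add: koszul_def br_simps g_simps field_simps)
    show "torsion br ?nab X Y = 0" for X Y
    proof (rule nondegenerate)
      fix Z
      show "g (torsion br ?nab X Y) Z = g 0 Z"
        unfolding torsion_def g_simps nab koszul_def anti[of Y X] anti[of X Z] anti[of Z Y]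
        by (simp add: bilinear_lzero[OF bilinear_g] g_simps field_simps)
    qed
    show "g (?nab X Y) Z + g Y (?nab X Z) = 0" for X Y Z
      unfolding g_commute[of Y "?nab X Z"] nab koszul_def anti[of Y X] anti[of X Z] anti[of Z Y]
      by (simp add: g_simps field_simps)
  qed
  moreover have "nab' = ?nab" if "is_levi_civita br g nab'" for nab'
    by (intro ext nondegenerate) (simp add: nab is_levi_civita_koszul[OF that])
  ultimately show eq: "levi_civita br g = ?nab"
    unfolding levi_civita_def by (rule the_equality)
  show "is_levi_civita br g (levi_civita br g)"
    unfolding eq by (rule lc)
qed

section \<open>The Wanas form and its operator\<close>

lemma bilinear_wanas_form:
  assumes "bilinear br" "bilinear nab"
  shows "bilinear (wanas_form br g nab e1 e2 e3)"
proof -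
  note [simp] = bilinear_ladd[OF assms(1)] bilinear_radd[OF assms(1)]
    bilinear_lsub[OF assms(1)] bilinear_rsub[OF assms(1)]
    bilinear_lmul[OF assms(1)] bilinear_rmul[OF assms(1)]
    bilinear_ladd[OF assms(2)] bilinear_radd[OF assms(2)]
    bilinear_lsub[OF assms(2)] bilinear_rsub[OF assms(2)]
    bilinear_lmul[OF assms(2)] bilinear_rmul[OF assms(2)]
  show ?thesis
    unfolding bilinear_def
    by (intro conjI allI linearI; simp add: wanas_form_def wanas_tensor_def curvature_def torsion_def g_simps;
        simp add: algebra_simps)
qed

text \<open>Linearity in the second slot makes the form representable, and nondegeneracy makes the
  representing map unique.\<close>

lemma wanas_operator_eq_sharp:
  assumes "\<And>X. linear (wanas_form br g nab e1 e2 e3 X)"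
  shows "wanas_operator br g nab e1 e2 e3 = (\<lambda>X. sharp (wanas_form br g nab e1 e2 e3 X))"
  unfolding wanas_operator_def
proof (rule the_equality)
  show "\<forall>X Y. wanas_form br g nab e1 e2 e3 X Y = g (sharp (wanas_form br g nab e1 e2 e3 X)) Y"
    by (simp add: g_sharp[OF assms])
next
  fix W
  assume "\<forall>X Y. wanas_form br g nab e1 e2 e3 X Y = g (W X) Y"
  then show "W = (\<lambda>X. sharp (wanas_form br g nab e1 e2 e3 X))"
    by (intro ext nondegenerate) (simp add: g_sharp[OF assms])
qed

end

section \<open>The Lie algebra of \<open>G_7\<close> in coordinates\<close>

text \<open>Here \<open>\<kappa> = \<gamma> / 2\<close>, which keeps the connection coefficients free of fractions.\<close>

locale g7 = lorentz_frame g e1 e2 e3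
  for g :: "'v::real_vector \<Rightarrow> 'v \<Rightarrow> real" and e1 e2 e3 :: 'v +
  fixes br :: "'v \<Rightarrow> 'v \<Rightarrow> 'v" and J :: "'v \<Rightarrow> 'v" and \<alpha> \<beta> \<kappa> \<delta> :: real
  assumes lie: "lie_bracket br"
    and br12: "br e1 e2 = - \<alpha> *\<^sub>R e1 - \<beta> *\<^sub>R e2 - \<beta> *\<^sub>R e3"
    and br13: "br e1 e3 = \<alpha> *\<^sub>R e1 + \<beta> *\<^sub>R e2 + \<beta> *\<^sub>R e3"
    and br23: "br e2 e3 = (2 * \<kappa>) *\<^sub>R e1 + \<delta> *\<^sub>R e2 + \<delta> *\<^sub>R e3"
    and linear_J: "linear J"
    and J: "J e1 = e1" "J e2 = e2" "J e3 = - e3"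
begin

lemma br_comb:
  "br (comb x y z) (comb x' y' z') =
    comb (\<alpha> * (y * x' - x * y' + x * z' - z * x') + 2 * \<kappa> * (y * z' - z * y'))
        (\<beta> * (y * x' - x * y' + x * z' - z * x') + \<delta> * (y * z' - z * y'))
        (\<beta> * (y * x' - x * y' + x * z' - z * x') + \<delta> * (y * z' - z * y'))"
proof -
  have bil: "bilinear br" and alt: "br X X = 0" for X
    using lie by (simp_all add: lie_bracket_def)
  note anti = lie_bracket_anticommute[OF lie]
  show ?thesis
    unfolding bilinear_comb[OF bil] alt anti[of e2 e1] anti[of e3 e1] anti[of e3 e2] br12 br13 br23
    by (simp add: comb_def algebra_simps)
qed

lemma J_comb: "J (comb x y z) = comb x y (- z)"
  by (simp add: linear_comb[OF linear_J] J) (simp add: comb_def)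

lemma levi_civita_comb:
  "levi_civita br g (comb x y z) (comb x' y' z') =
    comb (- \<alpha> * x * y' + \<alpha> * x * z' - \<beta> * y * y' + (\<kappa> + \<beta>) * y * z' + (\<beta> - \<kappa>) * z * y' - \<beta> * z * z')
        (\<alpha> * x * x' + \<kappa> * x * z' + \<beta> * y * x' + \<delta> * y * z' + (\<kappa> - \<beta>) * z * x' - \<delta> * z * z')
        (\<alpha> * x * x' + \<kappa> * x * y' + (\<kappa> + \<beta>) * y * x' + \<delta> * y * y' - \<beta> * z * x' - \<delta> * z * y')"
  by (simp add: levi_civita_eq_sharp[OF lie] sharp_comb koszul_def br_comb g_comb comb_eq_iff
      algebra_simps add_divide_distrib diff_divide_distrib)

text \<open>As \<open>J\<close> is an involution, this connection is the mean of \<nabla>_X Y and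
  J(\<nabla>_X(JY)), the part of \<nabla> preserving the eigenspaces of \<open>J\<close>. Hence
  \<open>e3\<close> is parallel and the plane of \<open>e1\<close>, \<open>e2\<close> undergoes an
  infinitesimal rotation.\<close>

lemma canonical_connection_comb:
  "canonical_connection br g J (comb x y z) (comb x' y' z') =
    comb ((- \<alpha> * x - \<beta> * y + (\<beta> - \<kappa>) * z) * y')
        ((\<alpha> * x + \<beta> * y - (\<beta> - \<kappa>) * z) * x') 0"
  unfolding canonical_connection_def cov_deriv_endo_def J_comb levi_civita_comb comb_arith comb_eq_iff
  by (simp add: algebra_simps)

lemma torsion_comb:
  "torsion br (canonical_connection br g J) (comb x y z) (comb x' y' z') =
    comb (\<alpha> * (z * x' - x * z') + (\<beta> + \<kappa>) * (z * y' - y * z'))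
        (\<kappa> * (z * x' - x * z') + \<delta> * (z * y' - y * z'))
        (\<beta> * (x * y' - y * x' + z * x' - x * z') + \<delta> * (z * y' - y * z'))"
  unfolding torsion_def canonical_connection_comb br_comb comb_arith comb_eq_iff
  by (simp add: algebra_simps)

abbreviation Wan :: "'v \<Rightarrow> 'v" where
  "Wan \<equiv> wanas_operator br g (canonical_connection br g J) e1 e2 e3"

text \<open>Writing the frame vectors as \<open>comb\<close> lets the coordinate rules in
  \<open>wanas_comb\<close> evaluate the form.\<close>

lemma wanas_form_comb:
  "wanas_form br g nab e1 e2 e3 X Y =
     - g (wanas_tensor br nab X (comb 1 0 0) Y) (comb 1 0 0)
     - g (wanas_tensor br nab X (comb 0 1 0) Y) (comb 0 1 0)
     + g (wanas_tensor br nab X (comb 0 0 1) Y) (comb 0 0 1)"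
  by (simp add: wanas_form_def comb_frame)

lemmas wanas_comb = wanas_form_comb wanas_tensor_def curvature_def
  torsion_comb canonical_connection_comb br_comb comb_arith g_comb
  bilinear_lzero[OF bilinear_g]

lemma bilinear_br: "bilinear br"
  using lie by (simp add: lie_bracket_def)

lemma bilinear_canonical_connection: "bilinear (canonical_connection br g J)"
proof -
  have "bilinear (levi_civita br g)"
    using is_levi_civita_levi_civita[OF lie] by (simp only: is_levi_civita_def)
  note [simp] = bilinear_ladd[OF this] bilinear_radd[OF this] bilinear_lmul[OF this] bilinear_rmul[OF this]
    linear_add[OF linear_J] linear_scale[OF linear_J]
  show ?thesis
    unfolding bilinear_def
    by (intro conjI allI linearI; simp add: canonical_connection_def cov_deriv_endo_def algebra_simps)
qed

lemmas bilinear_form = bilinear_wanas_form[OF bilinear_br bilinear_canonical_connection]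

lemma Wan_eq_sharp: "Wan X = sharp (wanas_form br g (canonical_connection br g J) e1 e2 e3 X)"
  using bilinear_form by (simp add: wanas_operator_eq_sharp bilinear_def)

lemma linear_Wan: "linear Wan"
  by (rule linearI)
    (simp_all add: Wan_eq_sharp sharp_def bilinear_ladd[OF bilinear_form] bilinear_lmul[OF bilinear_form] comb_arith)

text \<open>Curvature and torsion are expanded on numerical coordinates only;
  \<open>linear_Wan\<close> then extends the result to all vectors.\<close>

lemma Wan_frame:
  "Wan (comb 1 0 0) = comb (\<beta> * \<kappa> - \<beta>\<^sup>2 - \<alpha>\<^sup>2) (- \<alpha> * \<beta>) (- \<kappa> * \<delta> - \<alpha> * \<beta>)"
  "Wan (comb 0 1 0) = comb (- \<alpha> * \<beta>) (- \<delta>\<^sup>2 - 3 * \<beta> * \<kappa> - 2 * \<beta>\<^sup>2 - \<alpha>\<^sup>2) (- \<delta>\<^sup>2 - \<beta> * \<kappa> - \<beta>\<^sup>2)"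
  "Wan (comb 0 0 1) = comb (\<alpha> * \<beta> - 2 * \<alpha> * \<kappa>) (\<delta>\<^sup>2 + 2 * \<beta> * \<kappa> + \<beta>\<^sup>2 + \<alpha>\<^sup>2) (\<delta>\<^sup>2 + 2 * \<kappa>\<^sup>2 + 2 * \<beta> * \<kappa> + \<alpha>\<^sup>2)"
  by (simp_all add: Wan_eq_sharp sharp_comb wanas_comb comb_eq_iff power2_eq_square algebra_simps)

lemma Wan_comb:
  "Wan (comb x y z) =
    comb (x * (\<beta> * \<kappa> - \<beta>\<^sup>2 - \<alpha>\<^sup>2) - y * \<alpha> * \<beta> + z * (\<alpha> * \<beta> - 2 * \<alpha> * \<kappa>))
      (- x * \<alpha> * \<beta> - y * (\<delta>\<^sup>2 + 3 * \<beta> * \<kappa> + 2 * \<beta>\<^sup>2 + \<alpha>\<^sup>2) + z * (\<delta>\<^sup>2 + 2 * \<beta> * \<kappa> + \<beta>\<^sup>2 + \<alpha>\<^sup>2))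
      (- x * (\<kappa> * \<delta> + \<alpha> * \<beta>) - y * (\<delta>\<^sup>2 + \<beta> * \<kappa> + \<beta>\<^sup>2) + z * (\<delta>\<^sup>2 + 2 * \<kappa>\<^sup>2 + 2 * \<beta> * \<kappa> + \<alpha>\<^sup>2))"
  using linear_comb[OF linear_Wan, of x y z] Wan_frame
  by (simp add: comb_frame) (simp add: comb_arith comb_eq_iff algebra_simps)

section \<open>The soliton equation\<close>

lemma soliton_eq:
  assumes "wanas_soliton_with br g J e1 e2 e3 c D"
  shows "D X = Wan X - c *\<^sub>R X"
  using assms by (simp add: wanas_soliton_with_def)

lemma soliton_imp:
  assumes "wanas_soliton_with br g J e1 e2 e3 c D" and "\<alpha> + \<delta> \<noteq> 0" and "\<alpha> * \<kappa> = 0"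
  shows "\<alpha> = 0 \<and> \<kappa> = 0 \<and> \<beta>\<^sup>2 + c = 0"
proof -
  note D = soliton_eq[OF assms(1)]
  have der: "D (br X Y) = br (D X) Y + br X (D Y)" for X Y
    using assms(1) by (simp add: wanas_soliton_with_def derivation_def)
  note eqs = der[unfolded D, of "comb 1 0 0" "comb 0 1 0"] der[unfolded D, of "comb 1 0 0" "comb 0 0 1"]
    der[unfolded D, of "comb 0 1 0" "comb 0 0 1"]
  show ?thesis
  proof (cases "\<alpha> = 0")
    case True
    then have "\<delta> \<noteq> 0"
      using assms(2) by simp
    \<comment> \<open>This is the \<open>e1\<close>-component for [e1, e2]; it arises from the
      \<open>e3\<close>-part of \<open>D e1\<close> bracketed with \<open>e2\<close>.\<close>
    have "2 * (\<kappa>\<^sup>2 * \<delta>) = 0"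
      using eqs(1) True by (simp add: br_comb Wan_comb comb_arith comb_eq_iff power2_eq_square algebra_simps)
    then have "\<kappa> = 0"
      using \<open>\<delta> \<noteq> 0\<close> by simp
    \<comment> \<open>On \<open>e2 + e3\<close>, which spans the line of [e2, e3], \<open>D\<close>
      acts as -(\<beta>^2 + c), whereas the right-hand side is -2(\<beta>^2 + c) times that
      bracket.\<close>
    moreover have "\<delta> * (\<beta>\<^sup>2 + c) = 0"
      using eqs(3) True \<open>\<kappa> = 0\<close> by (simp add: br_comb Wan_comb comb_arith comb_eq_iff power2_eq_square algebra_simps)
    ultimately show ?thesis
      using True \<open>\<delta> \<noteq> 0\<close> by simp
  next
    case False
    then have "\<kappa> = 0"
      using assms(3) by simp
    have "\<alpha> * (c + \<beta>\<^sup>2 + \<alpha>\<^sup>2) = 0" "\<alpha> * (c + \<beta>\<^sup>2) = 0"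
      using eqs(1,2) \<open>\<kappa> = 0\<close> by (simp_all add: br_comb Wan_comb comb_arith comb_eq_iff power2_eq_square algebra_simps)
    then show ?thesis
      using False by simp
  qed
qed

text \<open>Under these conditions the only possible \<open>D\<close> maps into the line of
  \<open>e2 + e3\<close> and kills it. All brackets lie on that line, and both sides of the
  derivation identity vanish.\<close>

lemma soliton_conv:
  assumes "\<alpha> = 0" "\<kappa> = 0" "\<beta>\<^sup>2 + c = 0"
  shows "wanas_soliton_with br g J e1 e2 e3 c (\<lambda>X. Wan X - c *\<^sub>R X)"
proof -
  have c: "c = - \<beta>\<^sup>2"
    using assms(3) by simp
  have "Wan (br X Y) - c *\<^sub>R br X Y = br (Wan X - c *\<^sub>R X) Y + br X (Wan Y - c *\<^sub>R Y)" for X Y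
  proof -
    obtain x y z where X: "X = comb x y z" by (rule comb_cases)
    obtain x' y' z' where Y: "Y = comb x' y' z'" by (rule comb_cases)
    show ?thesis
      by (simp add: X Y c assms br_comb Wan_comb comb_arith comb_eq_iff) (simp add: algebra_simps)
  qed
  moreover have "linear (\<lambda>X. Wan X - c *\<^sub>R X)"
    by (intro linear_compose_sub linear_Wan linear_scale_self)
  ultimately show ?thesis
    by (simp add: wanas_soliton_with_def derivation_def)
qed

end

theorem theorem3p10:
  fixes br :: "'v::real_vector \<Rightarrow> 'v \<Rightarrow> 'v"
    and g :: "'v \<Rightarrow> 'v \<Rightarrow> real"
    and J :: "'v \<Rightarrow> 'v"
    and e1 e2 e3 :: 'v
    and \<alpha> \<beta> \<gamma> \<delta> c :: real
  assumes "\<alpha> + \<delta> \<noteq> 0" and "\<alpha> * \<gamma> = 0"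
    and "lie_bracket br"
    and "bilinear g" and "\<forall>X Y. g X Y = g Y X"
    and "pseudo_orthonormal_basis g e1 e2 e3"
    and "br e1 e2 = - \<alpha> *\<^sub>R e1 - \<beta> *\<^sub>R e2 - \<beta> *\<^sub>R e3"
    and "br e1 e3 = \<alpha> *\<^sub>R e1 + \<beta> *\<^sub>R e2 + \<beta> *\<^sub>R e3"
    and "br e2 e3 = \<gamma> *\<^sub>R e1 + \<delta> *\<^sub>R e2 + \<delta> *\<^sub>R e3"
    and "linear J" and "J e1 = e1" and "J e2 = e2" and "J e3 = - e3"
  shows "(first_kind_wanas_soliton br g J e1 e2 e3 c \<longleftrightarrow>
            \<alpha> = 0 \<and> \<gamma> = 0 \<and> \<beta>\<^sup>2 + c = 0 \<and> \<delta> \<noteq> 0) \<and>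
         (\<forall>D. wanas_soliton_with br g J e1 e2 e3 c D \<longrightarrow>
            D e1 = 0 \<and>
            D e2 = - (\<beta>\<^sup>2 + \<delta>\<^sup>2) *\<^sub>R e2 - (\<beta>\<^sup>2 + \<delta>\<^sup>2) *\<^sub>R e3 \<and>
            D e3 = (\<beta>\<^sup>2 + \<delta>\<^sup>2) *\<^sub>R e2 + (\<beta>\<^sup>2 + \<delta>\<^sup>2) *\<^sub>R e3)"
proof -
  interpret g7 g e1 e2 e3 br J \<alpha> \<beta> "\<gamma> / 2" \<delta>
    by (intro g7.intro lorentz_frame.intro g7_axioms.intro) (use assms in simp_all)
  have imp: "\<alpha> = 0" "\<gamma> = 0" "\<beta>\<^sup>2 + c = 0"
    if "wanas_soliton_with br g J e1 e2 e3 c D" for D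
    using soliton_imp[OF that] assms(1,2) by simp_all
  have "first_kind_wanas_soliton br g J e1 e2 e3 c \<longleftrightarrow>
      \<alpha> = 0 \<and> \<gamma> = 0 \<and> \<beta>\<^sup>2 + c = 0 \<and> \<delta> \<noteq> 0"
    \<comment> \<open>Once \<alpha> = 0, the condition \<delta> \<noteq> 0 is the hypothesis
      \<alpha> + \<delta> \<noteq> 0.\<close>
    unfolding first_kind_wanas_soliton_def using imp soliton_conv[of c] assms(1) by auto
  moreover have "D e1 = 0 \<and>
      D e2 = - (\<beta>\<^sup>2 + \<delta>\<^sup>2) *\<^sub>R e2 - (\<beta>\<^sup>2 + \<delta>\<^sup>2) *\<^sub>R e3 \<and>
      D e3 = (\<beta>\<^sup>2 + \<delta>\<^sup>2) *\<^sub>R e2 + (\<beta>\<^sup>2 + \<delta>\<^sup>2) *\<^sub>R e3"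
    if sol: "wanas_soliton_with br g J e1 e2 e3 c D" for D
  proof -
    have c: "c = - \<beta>\<^sup>2"
      using imp(3)[OF sol] by simp
    \<comment> \<open>With c = -\<beta>^2 the multiple of the identity cancels the
      \<open>e1\<close>-coordinate of \<open>Wan\<close>.\<close>
    have "D (comb x y z) = comb 0 ((\<beta>\<^sup>2 + \<delta>\<^sup>2) * (z - y)) ((\<beta>\<^sup>2 + \<delta>\<^sup>2) * (z - y))" for x y z
      by (simp add: soliton_eq[OF sol] Wan_comb imp(1,2)[OF sol] c comb_arith comb_eq_iff algebra_simps)
    from this[of 1 0 0] this[of 0 1 0] this[of 0 0 1] show ?thesis
      by (simp add: comb_frame) (simp add: comb_def algebra_simps)
  qed
  ultimately show ?thesis by blast
qed

end
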